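(* Let $T_n$ be a strongly connected arc-colored tournament of order $n$ with $\Delta^{-mon}(T_n)\leq\Delta^{+mon}(T_n)$. Then for each vertex $v$ of $T_n$, the number of rainbow triangles containing $v$ is at least $$\frac{\delta(v)\left(n-\delta(v)-i(T_n)\right)}{2}-\left[\Delta^{-mon}(T_{n})(n-1)+\Delta^{+mon}(T_{n})\,d^+(v)\right].$$
   Context: All digraphs are finite and simple. A tournament $T_n$ of order $n$ is a digraph on $n$ vertices in which each pair of distinct vertices is joined by precisely one arc. For a vertex $v$, $d^-(v)$ and $d^+(v)$ denote its indegree and outdegree, and $\delta(v)=\min\{d^-(v),d^+(v)\}$. The irregularity is $i(T_n)=\max_{v}|d^+(v)-d^-(v)|$, the maximum being over all vertices $v$ of $T_n$. A digraph is strongly connected if for every pair of distinct vertices $u,v$ there is a directed path from $u$ to $v$. An arc-coloring is an arbitrary map from the arc set to $\mathbb{N}$; an arc-colored tournament is a tournament equipped with an arc-coloring. $\Delta^{-mon}(T_n)$ (resp. $\Delta^{+mon}(T_n)$) is the maximum, over all vertices and all colors, of the number of in-arcs (resp. out-arcs) of that color at that vertex. A triangle means a directed cycle of length $3$ (counted as a subdigraph); it is rainbow if its three arcs have pairwise distinct colors. *)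

theory Defs
  imports Complex_Main "Graph_Theory.Digraph_Component"
begin

locale tournament = digraph G for G :: "('a, 'b) pre_digraph" (structure) +
  assumes unique_arc: "\<lbrakk>u \<in> verts G; v \<in> verts G; u \<noteq> v\<rbrakk> \<Longrightarrow>
    \<exists>!e. e \<in> arcs G \<and> {tail G e, head G e} = {u, v}"

definition min_semidegree :: "('a, 'b) pre_digraph \<Rightarrow> 'a \<Rightarrow> nat" where
  "min_semidegree G v = min (in_degree G v) (out_degree G v)"

definition irregularity :: "('a, 'b) pre_digraph \<Rightarrow> int" where
  "irregularity G = Max ((\<lambda>v. \<bar>int (out_degree G v) - int (in_degree G v)\<bar>) ` verts G)"

text \<open>An arc-coloring is a function on the arc type; only its values on the arcs matter. The maxima
  below range over all colors in \<^typ>\<open>nat\<close>, but the sets of values are finite, see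
  \<open>finite_mono_degrees\<close>.\<close>

definition max_in_mono_degree :: "('a, 'b) pre_digraph \<Rightarrow> ('b \<Rightarrow> nat) \<Rightarrow> nat" where
  "max_in_mono_degree G c =
    Max ((\<lambda>(v, k). card {e \<in> in_arcs G v. c e = k}) ` (verts G \<times> UNIV))"

definition max_out_mono_degree :: "('a, 'b) pre_digraph \<Rightarrow> ('b \<Rightarrow> nat) \<Rightarrow> nat" where
  "max_out_mono_degree G c =
    Max ((\<lambda>(v, k). card {e \<in> out_arcs G v. c e = k}) ` (verts G \<times> UNIV))"

lemma (in fin_digraph) finite_mono_degrees:
  fixes c :: "'b \<Rightarrow> nat"
  shows "finite ((\<lambda>(v, k). card {e \<in> in_arcs G v. c e = k}) ` (verts G \<times> UNIV))"
    and "finite ((\<lambda>(v, k). card {e \<in> out_arcs G v. c e = k}) ` (verts G \<times> UNIV))"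
proof -
  have "card {e \<in> in_arcs G v. c e = k} \<le> card (arcs G)"
    and "card {e \<in> out_arcs G v. c e = k} \<le> card (arcs G)" for v k
    by (rule card_mono; auto)+
  then have "(\<lambda>(v, k). card {e \<in> in_arcs G v. c e = k}) ` (verts G \<times> UNIV) \<subseteq> {..card (arcs G)}"
    and "(\<lambda>(v, k). card {e \<in> out_arcs G v. c e = k}) ` (verts G \<times> UNIV) \<subseteq> {..card (arcs G)}"
    by auto
  then show "finite ((\<lambda>(v, k). card {e \<in> in_arcs G v. c e = k}) ` (verts G \<times> UNIV))"
    and "finite ((\<lambda>(v, k). card {e \<in> out_arcs G v. c e = k}) ` (verts G \<times> UNIV))"
    by (simp_all only: finite_subset finite_atMost)
qed

definition directed_triangle :: "('a, 'b) pre_digraph \<Rightarrow> bool" where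
  "directed_triangle H \<longleftrightarrow>
    (\<exists>p. pre_digraph.cycle H p \<and> length p = 3 \<and> arcs H = set p \<and> verts H = tail H ` set p)"

text \<open>A subgraph shares the tail and head functions of the ambient digraph, so distinct elements of
  the following set differ in their vertices or arcs, i.e. as subdigraphs.\<close>

definition rainbow_triangles_at ::
    "('a, 'b) pre_digraph \<Rightarrow> ('b \<Rightarrow> nat) \<Rightarrow> 'a \<Rightarrow> ('a, 'b) pre_digraph set" where
  "rainbow_triangles_at G c v =
    {H. subgraph H G \<and> directed_triangle H \<and> inj_on c (arcs H) \<and> v \<in> verts H}"

lemma (in fin_digraph) finite_rainbow_triangles_at: "finite (rainbow_triangles_at G c v)"
proof (rule finite_subset)
  let ?f = "\<lambda>(V, A). \<lparr>verts = V, arcs = A, tail = tail G, head = head G\<rparr>"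
  show "rainbow_triangles_at G c v \<subseteq> ?f ` (Pow (verts G) \<times> Pow (arcs G))"
  proof
    fix H assume "H \<in> rainbow_triangles_at G c v"
    then have "verts H \<subseteq> verts G" "arcs H \<subseteq> arcs G" "tail G = tail H" "head G = head H"
      by (simp_all add: rainbow_triangles_at_def subgraph_def compatible_def)
    then have "H = ?f (verts H, arcs H)" "(verts H, arcs H) \<in> Pow (verts G) \<times> Pow (arcs G)"
      by simp_all
    then show "H \<in> ?f ` (Pow (verts G) \<times> Pow (arcs G))"
      by (rule image_eqI)
  qed
qed simp

end

theory Submission
  imports Defs
begin

text \<open>
  A directed triangle through \<open>v\<close> is determined by its arc opposite to \<open>v\<close>: an arc that leads from
  an out-neighbour of \<open>v\<close> to an in-neighbour of \<open>v\<close>. So the task is to count such opposite arcs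
  and to discard those whose triangle repeats a color.

  \<^emph>\<open>There are many opposite arcs.\<close> In a tournament every outdegree is at least \<open>(n - 1 - i) / 2\<close>,
  where \<open>i\<close> is the irregularity, and a set \<open>X\<close> of vertices spans at most \<open>|X| (|X| - 1) / 2\<close> arcs.
  Hence at least \<open>|X| (n - |X| - i) / 2\<close> arcs leave \<open>X\<close>, and by the same argument at least as many
  enter it (\<open>arcs_leaving_ge\<close>, \<open>arcs_entering_ge\<close>). An arc leaving the out-neighbourhood of \<open>v\<close>
  cannot end in \<open>v\<close>, so it is opposite to \<open>v\<close>; likewise, an arc entering the
  in-neighbourhood cannot start in \<open>v\<close>. Whichever of the two neighbourhoods has \<open>\<delta>(v)\<close> elements yields the main term of
  the bound (\<open>opposite_arcs_ge\<close>).

  \<^emph>\<open>Few of them fail to be rainbow.\<close> Let the triangle be \<open>v \<rightarrow> a \<rightarrow> b \<rightarrow> v\<close>. If \<open>va\<close> and \<open>ab\<close> agree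
  in color, then \<open>a\<close> leaves at most \<open>\<Delta>\<^sup>+\<close> choices for \<open>b\<close>; if \<open>va\<close> and \<open>bv\<close> agree, then \<open>a\<close> leaves
  at most \<open>\<Delta>\<^sup>-\<close> choices for \<open>b\<close>; if \<open>ab\<close> and \<open>bv\<close> agree, then \<open>b\<close> leaves at most \<open>\<Delta>\<^sup>-\<close> choices
  for \<open>a\<close>. The total is \<open>\<Delta>\<^sup>+ d\<^sup>+(v) + \<Delta>\<^sup>- (d\<^sup>+(v) + d\<^sup>-(v))\<close>, and \<open>d\<^sup>+(v) + d\<^sup>-(v) = n - 1\<close>.
\<close>

section \<open>Neighbourhoods and degrees in tournaments\<close>

text \<open>
  Each way of repeating a color below is counted by fixing one end of the opposite arc, so that a
  monochromatic degree bounds the choices for the other end.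
\<close>

lemma card_le_mult_fibre_bound:
  assumes "finite A" and "f ` S \<subseteq> A" and "finite S"
    and "\<And>a. a \<in> A \<Longrightarrow> card {s \<in> S. f s = a} \<le> d"
  shows "card S \<le> d * card A"
proof -
  have "S = (\<Union>a\<in>A. {s \<in> S. f s = a})"
    using assms(2) by auto
  then have "card S \<le> (\<Sum>a\<in>A. card {s \<in> S. f s = a})"
    using card_UN_le[OF assms(1), of "\<lambda>a. {s \<in> S. f s = a}"] by simp
  also have "\<dots> \<le> of_nat (card A) * d"
    by (rule sum_bounded_above) (rule assms(4))
  finally show ?thesis
    by (simp add: mult.commute)
qed

lemma (in fin_digraph) card_mono_in_arcs_le:
  fixes c :: "'b \<Rightarrow> nat"
  assumes "u \<in> verts G"
  shows "card {e \<in> in_arcs G u. c e = k} \<le> max_in_mono_degree G c"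
  unfolding max_in_mono_degree_def
  by (rule Max_ge[OF finite_mono_degrees(1)]) (use assms in force)

lemma (in fin_digraph) card_mono_out_arcs_le:
  fixes c :: "'b \<Rightarrow> nat"
  assumes "u \<in> verts G"
  shows "card {e \<in> out_arcs G u. c e = k} \<le> max_out_mono_degree G c"
  unfolding max_out_mono_degree_def
  by (rule Max_ge[OF finite_mono_degrees(2)]) (use assms in force)

definition out_nbrs :: "('a, 'b) pre_digraph \<Rightarrow> 'a \<Rightarrow> 'a set" where
  "out_nbrs G v = head G ` out_arcs G v"

definition in_nbrs :: "('a, 'b) pre_digraph \<Rightarrow> 'a \<Rightarrow> 'a set" where
  "in_nbrs G v = tail G ` in_arcs G v"

text \<open>Meaningful only when there is an arc from \<open>u\<close> to \<open>w\<close>, which is then unique in a tournament.\<close>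

definition arc_between :: "('a, 'b) pre_digraph \<Rightarrow> 'a \<Rightarrow> 'a \<Rightarrow> 'b" where
  "arc_between G u w = (THE e. e \<in> arcs G \<and> tail G e = u \<and> head G e = w)"

context tournament
begin

lemma arc_eqI:
  assumes "e \<in> arcs G" "f \<in> arcs G" "{tail G e, head G e} = {tail G f, head G f}"
  shows "e = f"
  using unique_arc[of "tail G f" "head G f"] no_loops[of f] assms by auto

lemma arc_between_eq:
  assumes "e \<in> arcs G"
  shows "arc_between G (tail G e) (head G e) = e"
  unfolding arc_between_def by (rule the_equality) (use assms arc_eqI in auto)

lemma out_nbr_arc:
  assumes "u \<in> out_nbrs G v"
  shows "arc_between G v u \<in> arcs G" "tail G (arc_between G v u) = v"
    "head G (arc_between G v u) = u"
  using assms arc_between_eq by (auto simp: out_nbrs_def)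

lemma in_nbr_arc:
  assumes "u \<in> in_nbrs G v"
  shows "arc_between G u v \<in> arcs G" "tail G (arc_between G u v) = u"
    "head G (arc_between G u v) = v"
  using assms arc_between_eq by (auto simp: in_nbrs_def)

lemma out_nbrs_subset: "out_nbrs G v \<subseteq> verts G"
  by (auto simp: out_nbrs_def)

lemma in_nbrs_subset: "in_nbrs G v \<subseteq> verts G"
  by (auto simp: in_nbrs_def)

lemma finite_nbrs: "finite (out_nbrs G v)" "finite (in_nbrs G v)"
  by (auto simp: out_nbrs_def in_nbrs_def)

lemma nbrs_partition:
  assumes "v \<in> verts G"
  shows "out_nbrs G v \<union> in_nbrs G v = verts G - {v}"
proof
  show "out_nbrs G v \<union> in_nbrs G v \<subseteq> verts G - {v}"
    using no_loops by (fastforce simp: out_nbrs_def in_nbrs_def)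
  show "verts G - {v} \<subseteq> out_nbrs G v \<union> in_nbrs G v"
  proof
    fix u assume "u \<in> verts G - {v}"
    then obtain e where e: "e \<in> arcs G" "{tail G e, head G e} = {u, v}"
      using unique_arc[of u v] assms by auto
    then consider "tail G e = u" "head G e = v" | "tail G e = v" "head G e = u"
      by (auto simp: doubleton_eq_iff)
    then show "u \<in> out_nbrs G v \<union> in_nbrs G v"
      by cases (use e in \<open>auto simp: out_nbrs_def in_nbrs_def\<close>)
  qed
qed

lemma not_self_nbr: "v \<notin> out_nbrs G v" "v \<notin> in_nbrs G v"
  using no_loops by (fastforce simp: out_nbrs_def in_nbrs_def)+

lemma nbrs_disjoint: "out_nbrs G v \<inter> in_nbrs G v = {}"
proof -
  have False if "u \<in> out_nbrs G v" "u \<in> in_nbrs G v" for u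
    using arc_eqI[of "arc_between G v u" "arc_between G u v"]
      out_nbr_arc[OF that(1)] in_nbr_arc[OF that(2)] not_self_nbr(1) that(1)
    by (metis insert_commute)
  then show ?thesis by auto
qed

lemma card_out_nbrs: "card (out_nbrs G v) = out_degree G v"
  unfolding out_nbrs_def out_degree_def
  by (rule card_image) (auto intro!: inj_onI arc_eqI)

lemma card_in_nbrs: "card (in_nbrs G v) = in_degree G v"
  unfolding in_nbrs_def in_degree_def
  by (rule card_image) (auto intro!: inj_onI arc_eqI)

lemma degree_sum:
  assumes "v \<in> verts G"
  shows "out_degree G v + in_degree G v + 1 = card (verts G)"
proof -
  have "card (verts G - {v}) = out_degree G v + in_degree G v"
    unfolding nbrs_partition[OF assms, symmetric] card_out_nbrs[symmetric] card_in_nbrs[symmetric]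
    by (rule card_Un_disjoint[OF finite_nbrs nbrs_disjoint])
  then show ?thesis
    using card_Suc_Diff1[OF finite_verts assms] by simp
qed

text \<open>The two degrees have sum \<open>n - 1\<close> and differ by at most the irregularity.\<close>

lemma degrees_ge:
  assumes "v \<in> verts G"
  shows "2 * int (out_degree G v) \<ge> int (card (verts G)) - 1 - irregularity G"
    and "2 * int (in_degree G v) \<ge> int (card (verts G)) - 1 - irregularity G"
proof -
  have "\<bar>int (out_degree G v) - int (in_degree G v)\<bar> \<le> irregularity G"
    unfolding irregularity_def by (rule Max_ge) (use assms in auto)
  with degree_sum[OF assms]
  show "2 * int (out_degree G v) \<ge> int (card (verts G)) - 1 - irregularity G"
    and "2 * int (in_degree G v) \<ge> int (card (verts G)) - 1 - irregularity G"
    by linarith+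
qed

section \<open>Arcs across a cut\<close>

text \<open>In a tournament, distinct arcs have distinct two-element sets of ends.\<close>

lemma card_arcs_within_le:
  assumes "finite X"
  shows "2 * int (card {e \<in> arcs G. tail G e \<in> X \<and> head G e \<in> X}) \<le> int (card X) * (int (card X) - 1)"
proof -
  let ?W = "{e \<in> arcs G. tail G e \<in> X \<and> head G e \<in> X}"
  have "card ?W \<le> card {Y. Y \<subseteq> X \<and> card Y = 2}"
  proof (rule card_inj_on_le)
    show "inj_on (\<lambda>e. {tail G e, head G e}) ?W"
      by (rule inj_onI) (auto intro: arc_eqI)
    show "(\<lambda>e. {tail G e, head G e}) ` ?W \<subseteq> {Y. Y \<subseteq> X \<and> card Y = 2}"
      using no_loops by (auto simp: card_insert_if)
    show "finite {Y. Y \<subseteq> X \<and> card Y = 2}"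
      using assms by simp
  qed
  also have "\<dots> = card X * (card X - 1) div 2"
    by (simp add: n_subsets[OF assms] choose_two)
  finally have "2 * card ?W \<le> card X * (card X - 1)"
    by linarith
  then have "int (2 * card ?W) \<le> int (card X * (card X - 1))"
    by (rule of_nat_mono)
  then show ?thesis
    by (cases "card X") (auto simp: algebra_simps)
qed

text \<open>
  The outdegrees in \<open>X\<close> add up to the number of arcs within \<open>X\<close>, which is small, plus the number of
  arcs leaving \<open>X\<close>.
\<close>

lemma arcs_leaving_ge:
  assumes "X \<subseteq> verts G"
  shows "2 * int (card {e \<in> arcs G. tail G e \<in> X \<and> head G e \<notin> X})
    \<ge> int (card X) * (int (card (verts G)) - int (card X) - irregularity G)"
proof -
  let ?i = "irregularity G" and ?n = "int (card (verts G))"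
  have fin: "finite X"
    by (rule finite_subset[OF assms finite_verts])
  let ?W = "{e \<in> arcs G. tail G e \<in> X \<and> head G e \<in> X}"
  let ?L = "{e \<in> arcs G. tail G e \<in> X \<and> head G e \<notin> X}"
  have "(\<Sum>u\<in>X. out_degree G u) = card (\<Union>u\<in>X. out_arcs G u)"
    unfolding out_degree_def by (rule card_UN_disjoint[symmetric]) (use fin in auto)
  also have "(\<Union>u\<in>X. out_arcs G u) = ?W \<union> ?L"
    by auto
  also have "card \<dots> = card ?W + card ?L"
    by (rule card_Un_disjoint) auto
  finally have "(\<Sum>u\<in>X. 2 * int (out_degree G u)) = 2 * int (card ?W) + 2 * int (card ?L)"
    by (simp flip: sum_distrib_left of_nat_sum)
  moreover have "(\<Sum>u\<in>X. 2 * int (out_degree G u)) \<ge> int (card X) * (?n - 1 - ?i)"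
    using assms degrees_ge(1) by (intro sum_bounded_below) auto
  ultimately show ?thesis
    using card_arcs_within_le[OF fin] by (simp add: algebra_simps)
qed

lemma arcs_entering_ge:
  assumes "X \<subseteq> verts G"
  shows "2 * int (card {e \<in> arcs G. tail G e \<notin> X \<and> head G e \<in> X})
    \<ge> int (card X) * (int (card (verts G)) - int (card X) - irregularity G)"
proof -
  let ?i = "irregularity G" and ?n = "int (card (verts G))"
  have fin: "finite X"
    by (rule finite_subset[OF assms finite_verts])
  let ?W = "{e \<in> arcs G. tail G e \<in> X \<and> head G e \<in> X}"
  let ?E = "{e \<in> arcs G. tail G e \<notin> X \<and> head G e \<in> X}"
  have "(\<Sum>u\<in>X. in_degree G u) = card (\<Union>u\<in>X. in_arcs G u)"
    unfolding in_degree_def by (rule card_UN_disjoint[symmetric]) (use fin in auto)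
  also have "(\<Union>u\<in>X. in_arcs G u) = ?W \<union> ?E"
    by auto
  also have "card \<dots> = card ?W + card ?E"
    by (rule card_Un_disjoint) auto
  finally have "(\<Sum>u\<in>X. 2 * int (in_degree G u)) = 2 * int (card ?W) + 2 * int (card ?E)"
    by (simp flip: sum_distrib_left of_nat_sum)
  moreover have "(\<Sum>u\<in>X. 2 * int (in_degree G u)) \<ge> int (card X) * (?n - 1 - ?i)"
    using assms degrees_ge(2) by (intro sum_bounded_below) auto
  ultimately show ?thesis
    using card_arcs_within_le[OF fin] by (simp add: algebra_simps)
qed

section \<open>Triangles through a vertex and their opposite arcs\<close>

definition opposite_arcs :: "'a \<Rightarrow> 'b set" where
  "opposite_arcs v = {e \<in> arcs G. tail G e \<in> out_nbrs G v \<and> head G e \<in> in_nbrs G v}"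

lemma finite_opposite_arcs: "finite (opposite_arcs v)"
  by (simp add: opposite_arcs_def)

text \<open>
  An arc that leaves the out-neighbourhood is opposite to \<open>v\<close>, and so is one that enters the
  in-neighbourhood: its other end is in the opposite neighbourhood or is \<open>v\<close> itself, and the latter
  would contradict the direction of the arcs at \<open>v\<close>. The two cut bounds are the same expression, at
  \<open>d\<^sup>+(v)\<close> and at \<open>d\<^sup>-(v)\<close>, so the one at \<open>\<delta>(v)\<close> can be chosen.
\<close>

lemma opposite_arcs_ge:
  assumes v: "v \<in> verts G"
  shows "2 * int (card (opposite_arcs v))
    \<ge> int (min_semidegree G v)
      * (int (card (verts G)) - int (min_semidegree G v) - irregularity G)"
proof (cases "in_degree G v \<le> out_degree G v")
  case True
  have "{e \<in> arcs G. tail G e \<notin> in_nbrs G v \<and> head G e \<in> in_nbrs G v} \<subseteq> opposite_arcs v"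
  proof clarify
    fix e assume e: "e \<in> arcs G" "tail G e \<notin> in_nbrs G v" "head G e \<in> in_nbrs G v"
    have "head G e \<notin> out_nbrs G v"
      using e nbrs_disjoint by blast
    then have "tail G e \<noteq> v"
      using e by (force simp: out_nbrs_def)
    then have "tail G e \<in> out_nbrs G v"
      using e nbrs_partition[OF v] tail_in_verts[of e] by blast
    then show "e \<in> opposite_arcs v"
      using e by (simp add: opposite_arcs_def)
  qed
  then have "card {e \<in> arcs G. tail G e \<notin> in_nbrs G v \<and> head G e \<in> in_nbrs G v}
      \<le> card (opposite_arcs v)"
    by (rule card_mono[OF finite_opposite_arcs])
  then show ?thesis
    using arcs_entering_ge[OF in_nbrs_subset[of v]] True
    by (simp add: card_in_nbrs min_semidegree_def)
next
  case False
  have "{e \<in> arcs G. tail G e \<in> out_nbrs G v \<and> head G e \<notin> out_nbrs G v} \<subseteq> opposite_arcs v"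
  proof clarify
    fix e assume e: "e \<in> arcs G" "tail G e \<in> out_nbrs G v" "head G e \<notin> out_nbrs G v"
    have "tail G e \<notin> in_nbrs G v"
      using e nbrs_disjoint by blast
    then have "head G e \<noteq> v"
      using e by (force simp: in_nbrs_def)
    then have "head G e \<in> in_nbrs G v"
      using e nbrs_partition[OF v] head_in_verts[of e] by blast
    then show "e \<in> opposite_arcs v"
      using e by (simp add: opposite_arcs_def)
  qed
  then have "card {e \<in> arcs G. tail G e \<in> out_nbrs G v \<and> head G e \<notin> out_nbrs G v}
      \<le> card (opposite_arcs v)"
    by (rule card_mono[OF finite_opposite_arcs])
  then show ?thesis
    using arcs_leaving_ge[OF out_nbrs_subset[of v]] False
    by (simp add: card_out_nbrs min_semidegree_def)
qed

definition triangle_arcs :: "'a \<Rightarrow> 'b \<Rightarrow> 'b set" where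
  "triangle_arcs v e = {arc_between G v (tail G e), e, arc_between G (head G e) v}"

definition triangle :: "'a \<Rightarrow> 'b \<Rightarrow> ('a, 'b) pre_digraph" where
  "triangle v e = \<lparr>verts = {v, tail G e, head G e}, arcs = triangle_arcs v e,
     tail = tail G, head = head G\<rparr>"

lemma triangle_is_rainbow_triangle_at:
  assumes e: "e \<in> opposite_arcs v" and v: "v \<in> verts G" and inj: "inj_on c (triangle_arcs v e)"
  shows "triangle v e \<in> rainbow_triangles_at G c v"
proof -
  let ?H = "triangle v e"
  let ?p = "[arc_between G v (tail G e), e, arc_between G (head G e) v]"
  have e': "e \<in> arcs G" "tail G e \<in> out_nbrs G v" "head G e \<in> in_nbrs G v"
    using e by (auto simp: opposite_arcs_def)
  note o = out_nbr_arc[OF e'(2)] and i = in_nbr_arc[OF e'(3)]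
  have wf: "wf_digraph ?H"
    by unfold_locales (auto simp: triangle_def triangle_arcs_def o i)
  have sub: "subgraph ?H G"
    unfolding subgraph_def compatible_def
    using wf e' v o i wf_digraph by (auto simp: triangle_def triangle_arcs_def)
  have distinct: "tail G e \<noteq> head G e" "tail G e \<noteq> v" "head G e \<noteq> v"
    using no_loops[OF e'(1)] e' not_self_nbr by auto
  have "pre_digraph.awalk ?H v ?p v" "distinct (tl (pre_digraph.awalk_verts ?H v ?p))"
    using distinct
    by (auto simp: pre_digraph.awalk_def pre_digraph.cas.simps pre_digraph.awalk_verts.simps
        triangle_def triangle_arcs_def o i)
  then have "pre_digraph.cycle ?H ?p"
    unfolding pre_digraph.cycle_def by blast
  then have "directed_triangle ?H"
    unfolding directed_triangle_def
    by (intro exI[of _ ?p]) (auto simp: triangle_def triangle_arcs_def o i)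
  with sub inj show ?thesis
    by (simp add: rainbow_triangles_at_def triangle_def)
qed

text \<open>
  This recovers the opposite arc from the triangle, so that counting opposite arcs does not count any
  triangle twice.
\<close>

lemma arc_of_triangle_missing_apex:
  assumes e: "e \<in> opposite_arcs v"
  shows "f \<in> triangle_arcs v e \<and> tail G f \<noteq> v \<and> head G f \<noteq> v \<longleftrightarrow> f = e"
proof -
  have nbrs: "tail G e \<in> out_nbrs G v" "head G e \<in> in_nbrs G v"
    using e by (simp_all add: opposite_arcs_def)
  have "tail G e \<noteq> v" "head G e \<noteq> v"
    using nbrs not_self_nbr[of v] by blast+
  then show ?thesis
    using out_nbr_arc(2)[OF nbrs(1)] in_nbr_arc(3)[OF nbrs(2)]
    unfolding triangle_arcs_def by blast
qed

lemma inj_on_triangle: "inj_on (triangle v) (opposite_arcs v)"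
proof (rule inj_onI)
  fix e f assume e: "e \<in> opposite_arcs v" and f: "f \<in> opposite_arcs v"
    and eq: "triangle v e = triangle v f"
  have "triangle_arcs v e = triangle_arcs v f"
    using arg_cong[OF eq, of arcs] unfolding triangle_def by (simp only: pre_digraph.select_convs)
  then show "e = f"
    using arc_of_triangle_missing_apex[OF e, of e] arc_of_triangle_missing_apex[OF f, of e] by blast
qed

section \<open>Triangles that repeat a color\<close>

lemma card_tail_and_opposite_same_color_le:
  fixes c :: "'b \<Rightarrow> nat"
  shows "card {e \<in> opposite_arcs v. c (arc_between G v (tail G e)) = c e}
    \<le> max_out_mono_degree G c * out_degree G v" (is "card ?S \<le> _")
  unfolding card_out_nbrs[symmetric]
proof (rule card_le_mult_fibre_bound[OF finite_nbrs(1), of "tail G"])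
  show "card {e \<in> ?S. tail G e = a} \<le> max_out_mono_degree G c" if "a \<in> out_nbrs G v" for a
  proof -
    have "{e \<in> ?S. tail G e = a} \<subseteq> {e \<in> out_arcs G a. c e = c (arc_between G v a)}"
      by (auto simp: opposite_arcs_def)
    then have "card {e \<in> ?S. tail G e = a} \<le> card {e \<in> out_arcs G a. c e = c (arc_between G v a)}"
      by (intro card_mono) auto
    also have "\<dots> \<le> max_out_mono_degree G c"
      using that out_nbrs_subset by (intro card_mono_out_arcs_le) auto
    finally show ?thesis .
  qed
qed (auto simp: opposite_arcs_def)

lemma card_opposite_and_head_same_color_le:
  fixes c :: "'b \<Rightarrow> nat"
  shows "card {e \<in> opposite_arcs v. c e = c (arc_between G (head G e) v)}
    \<le> max_in_mono_degree G c * in_degree G v" (is "card ?S \<le> _")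
  unfolding card_in_nbrs[symmetric]
proof (rule card_le_mult_fibre_bound[OF finite_nbrs(2), of "head G"])
  show "card {e \<in> ?S. head G e = b} \<le> max_in_mono_degree G c" if "b \<in> in_nbrs G v" for b
  proof -
    have "{e \<in> ?S. head G e = b} \<subseteq> {e \<in> in_arcs G b. c e = c (arc_between G b v)}"
      by (auto simp: opposite_arcs_def)
    then have "card {e \<in> ?S. head G e = b} \<le> card {e \<in> in_arcs G b. c e = c (arc_between G b v)}"
      by (intro card_mono) auto
    also have "\<dots> \<le> max_in_mono_degree G c"
      using that in_nbrs_subset by (intro card_mono_in_arcs_le) auto
    finally show ?thesis .
  qed
qed (auto simp: opposite_arcs_def)

text \<open>
  Here the relevant monochromatic in-arcs are those at \<open>v\<close> itself. Grouping by the out-neighbour \<open>a\<close>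
  brings in \<open>\<Delta>\<^sup>-\<close>: the arc from \<open>v\<close> to \<open>a\<close> fixes the color, and distinct opposite arcs
  starting in \<open>a\<close> are followed by distinct arcs into \<open>v\<close>.
\<close>

lemma card_tail_and_head_same_color_le:
  fixes c :: "'b \<Rightarrow> nat"
  assumes "v \<in> verts G"
  shows "card {e \<in> opposite_arcs v. c (arc_between G v (tail G e)) = c (arc_between G (head G e) v)}
    \<le> max_in_mono_degree G c * out_degree G v" (is "card ?S \<le> _")
  unfolding card_out_nbrs[symmetric]
proof (rule card_le_mult_fibre_bound[OF finite_nbrs(1), of "tail G"])
  show "card {e \<in> ?S. tail G e = a} \<le> max_in_mono_degree G c" if "a \<in> out_nbrs G v" for a
  proof -
    let ?F = "{e \<in> ?S. tail G e = a}"
    have "card ?F \<le> card {f \<in> in_arcs G v. c f = c (arc_between G v a)}"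
    proof (rule card_inj_on_le)
      show "inj_on (\<lambda>e. arc_between G (head G e) v) ?F"
      proof (rule inj_onI)
        fix e f assume ef: "e \<in> ?F" "f \<in> ?F"
          and eq: "arc_between G (head G e) v = arc_between G (head G f) v"
        have "head G e \<in> in_nbrs G v" "head G f \<in> in_nbrs G v"
          using ef by (auto simp: opposite_arcs_def)
        then have "head G e = head G f"
          using in_nbr_arc(2) eq by metis
        then show "e = f"
          using ef by (auto simp: opposite_arcs_def intro: arc_eqI)
      qed
      show "(\<lambda>e. arc_between G (head G e) v) ` ?F
          \<subseteq> {f \<in> in_arcs G v. c f = c (arc_between G v a)}"
        by (auto simp: opposite_arcs_def in_nbr_arc)
    qed auto
    also have "\<dots> \<le> max_in_mono_degree G c"
      using assms by (rule card_mono_in_arcs_le)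
    finally show ?thesis .
  qed
qed (auto simp: opposite_arcs_def)

text \<open>
  An opposite arc yields a rainbow triangle unless two of the three arcs of its triangle agree in
  color, so the three counts above bound the loss.
\<close>

lemma card_opposite_arcs_le:
  fixes c :: "'b \<Rightarrow> nat"
  assumes v: "v \<in> verts G"
  shows "card (opposite_arcs v) \<le> card (rainbow_triangles_at G c v)
    + max_in_mono_degree G c * (out_degree G v + in_degree G v)
    + max_out_mono_degree G c * out_degree G v"
proof -
  let ?R = "{e \<in> opposite_arcs v. inj_on c (triangle_arcs v e)}"
  let ?S1 = "{e \<in> opposite_arcs v. c (arc_between G v (tail G e)) = c e}"
  let ?S2 = "{e \<in> opposite_arcs v. c e = c (arc_between G (head G e) v)}"
  let ?S3 = "{e \<in> opposite_arcs v. c (arc_between G v (tail G e)) = c (arc_between G (head G e) v)}"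
  have "opposite_arcs v \<subseteq> ?R \<union> ?S1 \<union> ?S2 \<union> ?S3"
    by (auto simp: triangle_arcs_def inj_on_def)
  then have "card (opposite_arcs v) \<le> card (?R \<union> ?S1 \<union> ?S2 \<union> ?S3)"
    by (rule card_mono[rotated]) (simp add: finite_opposite_arcs)
  also have "\<dots> \<le> card ?R + card ?S1 + card ?S2 + card ?S3"
    by (meson add_le_mono1 card_Un_le order_trans)
  finally have "card (opposite_arcs v) \<le> card ?R + card ?S1 + card ?S2 + card ?S3" .
  moreover have "card ?R \<le> card (rainbow_triangles_at G c v)"
  proof (rule card_inj_on_le[OF _ _ finite_rainbow_triangles_at])
    show "inj_on (triangle v) ?R"
      by (rule inj_on_subset[OF inj_on_triangle]) auto
    show "triangle v ` ?R \<subseteq> rainbow_triangles_at G c v"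
      using triangle_is_rainbow_triangle_at v by auto
  qed
  ultimately show ?thesis
    using card_tail_and_opposite_same_color_le[of v c] card_opposite_and_head_same_color_le[of v c]
      card_tail_and_head_same_color_le[OF v, of c]
    by (simp add: algebra_simps)
qed

end

section \<open>The lower bound\<close>

theorem theorem1:
  fixes T :: "('a, 'b) pre_digraph" and c :: "'b \<Rightarrow> nat" and n :: nat and v :: 'a
  assumes "tournament T"
    and "card (verts T) = n"
    and "strongly_connected T"
    and "max_in_mono_degree T c \<le> max_out_mono_degree T c"
    and "v \<in> verts T"
  shows "real (card (rainbow_triangles_at T c v)) \<ge>
    real (min_semidegree T v) * (real n - real (min_semidegree T v) - real_of_int (irregularity T)) / 2
    - (real (max_in_mono_degree T c) * (real n - 1)
       + real (max_out_mono_degree T c) * real (out_degree T v))"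
proof -
  interpret tournament T by fact
  let ?d = "min_semidegree T v" and ?i = "irregularity T"
  have "real_of_int (int ?d * (int n - int ?d - ?i)) \<le> real_of_int (2 * int (card (opposite_arcs v)))"
    using opposite_arcs_ge[OF assms(5)] unfolding assms(2) by (rule of_int_le_iff[THEN iffD2])
  then have many: "real ?d * (real n - real ?d - ?i) / 2 \<le> real (card (opposite_arcs v))"
    by simp
  have deg: "real (out_degree T v + in_degree T v) = real n - 1"
    using degree_sum[OF assms(5)] assms(2) by linarith
  have "real (card (opposite_arcs v)) \<le> real (card (rainbow_triangles_at T c v)
      + max_in_mono_degree T c * (out_degree T v + in_degree T v)
      + max_out_mono_degree T c * out_degree T v)"
    using card_opposite_arcs_le[OF assms(5)] by (rule of_nat_mono)
  also have "\<dots> = real (card (rainbow_triangles_at T c v))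
      + real (max_in_mono_degree T c) * (real n - 1)
      + real (max_out_mono_degree T c) * real (out_degree T v)"
    by (simp only: of_nat_add[of "_ + _ * _"] of_nat_add[of "card _"] of_nat_mult deg)
  finally show ?thesis
    using many by linarith
qed

end
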